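(* Let $T$ be a tournament and let $c$ be a real number. If $\vec{\chi}_f(T) \le c$, then $$\gamma^+(T) \le \lceil 2c \ln(2c) \rceil .$$
   Context: A tournament $T$ is a finite directed graph with vertex set $V(T)$ and arc set $A(T)$ having, for each pair of distinct vertices, exactly one of the two possible arcs, and no loops. For $S \subseteq V(T)$, $T[S]$ is the subtournament induced on $S$; it is transitive if it contains no directed cycle (equivalently, $S$ can be linearly ordered so that all arcs go from earlier to later vertices). Fractional dichromatic number: let $\mathcal{S}$ be the family of all $S \subseteq V(T)$ such that $T[S]$ is transitive. Then $\vec{\chi}_f(T)$ is the optimal value of the linear program: minimize $\sum_{S \in \mathcal{S}} z_S$ subject to $\sum_{S \in \mathcal{S}: v \in S} z_S \ge 1$ for every $v \in V(T)$, and $z_S \ge 0$ for every $S \in \mathcal{S}$. Domination number: a set $X \subseteq V(T)$ is a dominating set of $T$ if every vertex of $T$ either belongs to $X$ or has at least one in-neighbor in $X$ (i.e. there is $x \in X$ with $xv \in A(T)$). $\gamma^+(T)$ is the minimum size of a dominating set of $T$. $\ln$ is the natural logarithm. *)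

theory Defs
  imports Complex_Main "Graph_Theory.Graph_Theory"
begin

text \<open>The null tournament, with no vertices, is not excluded.\<close>

locale tournament = digraph +
  assumes exactly_one_arc:
    "\<lbrakk>u \<in> verts G; v \<in> verts G; u \<noteq> v\<rbrakk> \<Longrightarrow> (u \<rightarrow> v) \<noteq> (v \<rightarrow> u)"

definition transitive_sets :: "('a, 'b) pre_digraph \<Rightarrow> 'a set set" where
  "transitive_sets T = {S. S \<subseteq> verts T \<and> (\<nexists>p. pre_digraph.cycle (T \<restriction> S) p)}"

definition fractional_dicolouring :: "('a, 'b) pre_digraph \<Rightarrow> ('a set \<Rightarrow> real) \<Rightarrow> bool" where
  "fractional_dicolouring T z \<longleftrightarrow>
     (\<forall>S \<in> transitive_sets T. z S \<ge> 0) \<and>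
     (\<forall>v \<in> verts T. (\<Sum>S | S \<in> transitive_sets T \<and> v \<in> S. z S) \<ge> 1)"

text \<open>
  For finite, loop-free \<open>T\<close> the linear program is feasible and its objective is bounded below
  (see the lemmas below), so this infimum is the optimal value.
\<close>

definition fractional_dichromatic_number :: "('a, 'b) pre_digraph \<Rightarrow> real" where
  "fractional_dichromatic_number T =
     Inf {(\<Sum>S \<in> transitive_sets T. z S) | z. fractional_dicolouring T z}"

definition dominating_set :: "('a, 'b) pre_digraph \<Rightarrow> 'a set \<Rightarrow> bool" where
  "dominating_set T X \<longleftrightarrow>
     X \<subseteq> verts T \<and> (\<forall>v \<in> verts T. v \<in> X \<or> (\<exists>x \<in> X. x \<rightarrow>\<^bsub>T\<^esub> v))"

definition domination_number :: "('a, 'b) pre_digraph \<Rightarrow> nat" where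
  "domination_number T = Min {card X | X. dominating_set T X}"

lemma bdd_below_fractional_dicolouring:
  "bdd_below {(\<Sum>S \<in> transitive_sets T. z S) | z. fractional_dicolouring T z}"
  by (rule bdd_belowI[of _ 0]) (auto simp: fractional_dicolouring_def intro!: sum_nonneg)

context digraph
begin

lemma finite_transitive_sets: "finite (transitive_sets G)"
  by (rule finite_subset[of _ "Pow (verts G)"]) (auto simp: transitive_sets_def)

lemma singleton_in_transitive_sets:
  assumes "v \<in> verts G"
  shows "{v} \<in> transitive_sets G"
proof -
  have no_arcs: "arcs (G \<restriction> {v}) = {}"
    using no_loops by fastforce
  have "\<not> pre_digraph.cycle (G \<restriction> {v}) p" for p
    unfolding pre_digraph.cycle_def pre_digraph.awalk_def no_arcs by auto
  with assms show ?thesis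
    by (auto simp: transitive_sets_def)
qed

lemma fractional_dicolouring_exists: "fractional_dicolouring G (\<lambda>_. 1)"
  unfolding fractional_dicolouring_def
proof (intro conjI ballI)
  fix v assume v: "v \<in> verts G"
  have "finite {S. S \<in> transitive_sets G \<and> v \<in> S}"
    using finite_transitive_sets by simp
  moreover have "{v} \<in> {S. S \<in> transitive_sets G \<and> v \<in> S}"
    using singleton_in_transitive_sets[OF v] by simp
  ultimately have "card {S. S \<in> transitive_sets G \<and> v \<in> S} \<ge> 1"
    by (metis One_nat_def Suc_leI card_gt_0_iff empty_iff)
  then show "(\<Sum>S | S \<in> transitive_sets G \<and> v \<in> S. 1 :: real) \<ge> 1"
    by simp
qed simp

lemma dominating_set_verts: "dominating_set G (verts G)"
  by (simp add: dominating_set_def)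

lemma finite_card_dominating_sets: "finite {card X | X. dominating_set G X}"
proof -
  have "{card X | X. dominating_set G X} \<subseteq> card ` Pow (verts G)"
    by (auto simp: dominating_set_def)
  then show ?thesis
    by (rule finite_subset) simp
qed

end

end

theory Submission
  imports Defs "HOL-Analysis.Analysis"
begin

text \<open>
  Put \<open>k = \<lceil>2c ln (2c)\<rceil>\<close> and suppose that no \<open>k\<close> vertices dominate \<open>T\<close>. Then every \<open>k\<close>-tuple
  \<open>X\<close> of vertices has a vertex \<open>w X\<close> outside it that no entry of \<open>X\<close> beats. Sending a
  probability law \<open>p\<close> on the vertices to the law of \<open>w X\<close>, where the entries of \<open>X\<close> are drawn
  independently from \<open>p\<close>, is a polynomial self-map of a simplex; by Brouwer's theorem some
  law \<open>p\<close> reproduces itself (\<open>self_reproducing_law\<close>).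

  Linear programming duality, in its easy direction, gives a transitive set \<open>S\<close> with
  \<open>p(S) \<ge> 1/c\<close> (\<open>heavy_transitive_set\<close>). Order \<open>S\<close> along its arcs and choose a median \<open>t\<close>: the
  part \<open>A\<close> up to \<open>t\<close> has mass at least \<open>1/(2c)\<close>, the part \<open>B\<close> from \<open>t\<close> on has mass more than
  \<open>1/(2c)\<close> (\<open>weighted_median\<close>). Every vertex of \<open>A\<close> equals or beats every vertex of \<open>B\<close>, so
  \<open>w X\<close> can lie in \<open>B\<close> only if \<open>X\<close> misses \<open>A\<close>. As \<open>w X\<close> has law \<open>p\<close>, this yields
  \<open>1/(2c) < p(B) \<le> (1 - p(A))\<^sup>k \<le> (1 - 1/(2c))\<^sup>k \<le> 1/(2c)\<close>, a contradiction.

  The number of vertices, hence the dimension of the simplex, is not the cardinality of a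
  fixed type, so the fixed point is found in spaces of functions with the product topology,
  directly from Kuhn's combinatorial lemma.
\<close>

section \<open>Brouwer's theorem in dimension \<open>n\<close>\<close>

text \<open>
  The coordinates from \<open>n\<close> on are pinned to \<open>0\<close>, so that this copy of \<open>[0,1]\<^sup>n\<close> is compact in
  the product topology.
\<close>

definition unit_cube :: "nat \<Rightarrow> (nat \<Rightarrow> real) set" where
  "unit_cube n = (\<Pi>\<^sub>E i\<in>UNIV. if i < n then {0..1} else {0})"

lemma mem_unit_cube_iff:
  "x \<in> unit_cube n \<longleftrightarrow> (\<forall>i<n. 0 \<le> x i \<and> x i \<le> 1) \<and> (\<forall>i\<ge>n. x i = 0)"
  by (auto simp: unit_cube_def PiE_iff not_less split: if_splits)

lemma compact_unit_cube: "compact (unit_cube n)"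
proof -
  have "compactin (product_topology (\<lambda>_. euclidean) UNIV) (unit_cube n)"
    unfolding unit_cube_def by (subst compactin_PiE) auto
  then show ?thesis
    by (simp add: euclidean_product_topology)
qed

lemma continuous_on_coordinate: "continuous_on A (\<lambda>x. x i)"
  by (rule continuous_on_product_then_coordinatewise[OF continuous_on_id])

text \<open>
  Kuhn's lemma on grids of mesh \<open>1/(m + 1)\<close> gives, for each coordinate \<open>i\<close>, two nearby grid
  points, at one of which \<open>f\<close> does not decrease coordinate \<open>i\<close> and at the other of which it
  does not increase it. Along a convergent subsequence all these points tend to one limit,
  where continuity turns the two inequalities into an equality.
\<close>

theorem unit_cube_fixpoint:
  fixes f :: "(nat \<Rightarrow> real) \<Rightarrow> nat \<Rightarrow> real"
  assumes cont: "continuous_on (unit_cube n) f"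
    and maps: "f ` unit_cube n \<subseteq> unit_cube n"
  obtains x where "x \<in> unit_cube n" "f x = x"
proof -
  define grid where "grid m r = (\<lambda>i. if i < n then real (r i) / real (Suc m) else 0)"
    for m and r :: "nat \<Rightarrow> nat"
  have grid_cube: "grid m r \<in> unit_cube n" if "\<forall>i<n. r i \<le> Suc m" for m r
    using that by (auto simp: mem_unit_cube_iff grid_def simp del: of_nat_Suc)
  have f_cube: "f x \<in> unit_cube n" if "x \<in> unit_cube n" for x
    using maps that by blast
  have "\<exists>q. (\<forall>i<n. q i \<le> Suc m) \<and> (\<forall>i<n. \<exists>r s.
      (\<forall>j<n. q j \<le> r j \<and> r j \<le> q j + 1 \<and> r j \<le> Suc m) \<and>
      (\<forall>j<n. q j \<le> s j \<and> s j \<le> q j + 1 \<and> s j \<le> Suc m) \<and>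
      grid m r i \<le> f (grid m r) i \<and> f (grid m s) i \<le> grid m s i)" for m
  proof -
    (* A label 0 claims that f does not decrease the coordinate, a label 1 that it does not
       increase it; on the faces of the cube both the claim and the label are forced. *)
    define label :: "(nat \<Rightarrow> nat) \<Rightarrow> nat \<Rightarrow> nat" where
      "label r i = (if r i = 0 then 0 else if r i = Suc m then 1
        else if grid m r i \<le> f (grid m r) i then 0 else 1)" for r i
    have lab0: "grid m r i \<le> f (grid m r) i"
      if "label r i = 0" "i < n" "\<forall>i<n. r i \<le> Suc m" for r i
      using that f_cube[OF grid_cube[OF that(3)]]
      by (auto simp: label_def mem_unit_cube_iff grid_def split: if_splits)
    have lab1: "f (grid m r) i \<le> grid m r i"
      if "label r i \<noteq> 0" "i < n" "\<forall>i<n. r i \<le> Suc m" for r i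
    proof (cases "r i = Suc m")
      case True
      then have "grid m r i = 1" using that(2) by (simp add: grid_def)
      then show ?thesis
        using that f_cube[OF grid_cube[OF that(3)]] by (auto simp: mem_unit_cube_iff)
    qed (use that in \<open>auto simp: label_def split: if_splits\<close>)
    obtain q where q: "\<forall>i<n. q i < Suc m"
      and sep: "\<forall>i<n. \<exists>r s. (\<forall>j<n. q j \<le> r j \<and> r j \<le> q j + 1) \<and>
        (\<forall>j<n. q j \<le> s j \<and> s j \<le> q j + 1) \<and> label r i \<noteq> label s i"
      by (rule kuhn_lemma[of "Suc m" n label]) (auto simp: label_def)
    show ?thesis
    proof (rule exI[of _ q], intro conjI allI impI)
      fix i assume i: "i < n"
      obtain r s where rs: "\<forall>j<n. q j \<le> r j \<and> r j \<le> q j + 1"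
        "\<forall>j<n. q j \<le> s j \<and> s j \<le> q j + 1" "label r i \<noteq> label s i"
        using sep i by blast
      have bd: "\<forall>j<n. r j \<le> Suc m" "\<forall>j<n. s j \<le> Suc m"
        using rs q by (metis Suc_eq_plus1 Suc_leI le_trans)+
      have "label r i = 0 \<and> label s i \<noteq> 0 \<or> label s i = 0 \<and> label r i \<noteq> 0"
        using rs(3) by (auto simp: label_def split: if_splits)
      then show "\<exists>r s. (\<forall>j<n. q j \<le> r j \<and> r j \<le> q j + 1 \<and> r j \<le> Suc m) \<and>
          (\<forall>j<n. q j \<le> s j \<and> s j \<le> q j + 1 \<and> s j \<le> Suc m) \<and>
          grid m r i \<le> f (grid m r) i \<and> f (grid m s) i \<le> grid m s i"
        using rs(1,2) bd lab0 lab1 i by blast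
    qed (use q in \<open>auto intro: less_imp_le\<close>)
  qed
  then obtain Q where Q: "\<And>m. \<forall>i<n. Q m i \<le> Suc m"
    and ex: "\<And>m. \<forall>i<n. \<exists>r s.
      (\<forall>j<n. Q m j \<le> r j \<and> r j \<le> Q m j + 1 \<and> r j \<le> Suc m) \<and>
      (\<forall>j<n. Q m j \<le> s j \<and> s j \<le> Q m j + 1 \<and> s j \<le> Suc m) \<and>
      grid m r i \<le> f (grid m r) i \<and> f (grid m s) i \<le> grid m s i"
    by metis
  have "seq_compact (unit_cube n)"
    by (rule compact_imp_seq_compact[OF compact_unit_cube])
  then obtain x \<phi> where x: "x \<in> unit_cube n" and mono: "strict_mono (\<phi> :: nat \<Rightarrow> nat)"
    and lim: "((\<lambda>m. grid m (Q m)) \<circ> \<phi>) \<longlonglongrightarrow> x"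
    using grid_cube[OF Q] by (metis seq_compactE)
  have coord: "(\<lambda>k. y k i) \<longlonglongrightarrow> z i" if "y \<longlonglongrightarrow> z" for y :: "nat \<Rightarrow> nat \<Rightarrow> real" and z i
    using that continuous_on_tendsto_compose[of UNIV "\<lambda>x. x i" y z sequentially]
    by simp
  have inv: "(\<lambda>k. 1 / real (Suc (\<phi> k))) \<longlonglongrightarrow> 0"
    using LIMSEQ_subseq_LIMSEQ[OF lim_1_over_n[THEN LIMSEQ_Suc] mono]
    by (simp add: o_def)
  (* Every choice of grid points in the Kuhn cells tends to x, not just their corners Q. *)
  have near: "(\<lambda>k. grid (\<phi> k) (r k)) \<longlonglongrightarrow> x"
    if r: "\<And>k. \<forall>j<n. Q (\<phi> k) j \<le> r k j \<and> r k j \<le> Q (\<phi> k) j + 1" for r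
  proof -
    have "(\<lambda>k. grid (\<phi> k) (r k) j) \<longlonglongrightarrow> x j" for j
    proof (rule tendsto_sandwich)
      show "(\<lambda>k. grid (\<phi> k) (Q (\<phi> k)) j) \<longlonglongrightarrow> x j"
        using coord[OF lim] by (simp add: o_def)
      then show "(\<lambda>k. grid (\<phi> k) (Q (\<phi> k)) j + 1 / real (Suc (\<phi> k))) \<longlonglongrightarrow> x j"
        using tendsto_add[OF _ inv] by fastforce
      show "\<forall>\<^sub>F k in sequentially. grid (\<phi> k) (Q (\<phi> k)) j \<le> grid (\<phi> k) (r k) j"
        using r by (auto simp: grid_def divide_right_mono)
      have "real (r k j) \<le> real (Q (\<phi> k) j) + 1" if "j < n" for k
        using r that by (metis of_nat_1 of_nat_add of_nat_le_iff)
      then show "\<forall>\<^sub>F k in sequentially.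
          grid (\<phi> k) (r k) j \<le> grid (\<phi> k) (Q (\<phi> k)) j + 1 / real (Suc (\<phi> k))"
        by (auto simp: grid_def add_divide_distrib[symmetric] divide_right_mono simp del: of_nat_Suc)
    qed
    then show ?thesis
      by (simp add: limitin_componentwise euclidean_product_topology[symmetric]
            flip: limitin_canonical_iff)
  qed
  have lim_f: "(\<lambda>k. f (y k) i) \<longlonglongrightarrow> f x i" if "y \<longlonglongrightarrow> x" "\<And>k. y k \<in> unit_cube n" for y i
    using continuous_on_tendsto_compose[OF cont that(1) x] that(2) by (intro coord) auto
  have "f x i = x i" for i
  proof (cases "i < n")
    case True
    then have "\<forall>k. \<exists>r s.
      (\<forall>j<n. Q (\<phi> k) j \<le> r j \<and> r j \<le> Q (\<phi> k) j + 1 \<and> r j \<le> Suc (\<phi> k)) \<and>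
      (\<forall>j<n. Q (\<phi> k) j \<le> s j \<and> s j \<le> Q (\<phi> k) j + 1 \<and> s j \<le> Suc (\<phi> k)) \<and>
      grid (\<phi> k) r i \<le> f (grid (\<phi> k) r) i \<and> f (grid (\<phi> k) s) i \<le> grid (\<phi> k) s i"
      using ex by blast
    then obtain r s where
      r: "\<And>k. \<forall>j<n. Q (\<phi> k) j \<le> r k j \<and> r k j \<le> Q (\<phi> k) j + 1 \<and> r k j \<le> Suc (\<phi> k)" and
      s: "\<And>k. \<forall>j<n. Q (\<phi> k) j \<le> s k j \<and> s k j \<le> Q (\<phi> k) j + 1 \<and> s k j \<le> Suc (\<phi> k)" and
      le: "\<And>k. grid (\<phi> k) (r k) i \<le> f (grid (\<phi> k) (r k)) i"
        "\<And>k. f (grid (\<phi> k) (s k)) i \<le> grid (\<phi> k) (s k) i"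
      by metis
    have lr: "(\<lambda>k. grid (\<phi> k) (r k)) \<longlonglongrightarrow> x" and ls: "(\<lambda>k. grid (\<phi> k) (s k)) \<longlonglongrightarrow> x"
      using near r s by blast+
    have "x i \<le> f x i"
      by (rule LIMSEQ_le[OF coord[OF lr] lim_f[OF lr]]) (use le grid_cube r in blast)+
    moreover have "f x i \<le> x i"
      by (rule LIMSEQ_le[OF lim_f[OF ls] coord[OF ls]]) (use le grid_cube s in blast)+
    ultimately show ?thesis by simp
  qed (use x f_cube in \<open>auto simp: mem_unit_cube_iff not_less\<close>)
  then show thesis
    using that[OF x] by blast
qed

definition prob_simplex :: "'a set \<Rightarrow> ('a \<Rightarrow> real) set" where
  "prob_simplex I = {p. (\<forall>a. 0 \<le> p a) \<and> (\<forall>a. a \<notin> I \<longrightarrow> p a = 0) \<and> sum p I = 1}"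

text \<open>
  The simplex is a retract of the cube: a point of mass \<open>\<sigma> \<ge> 1\<close> is divided by \<open>\<sigma>\<close>, and to a point
  of mass \<open>\<sigma> < 1\<close> the missing mass is added uniformly (\<open>norml\<close> below). A fixed point of \<open>F\<close>
  composed with the retraction has mass \<open>1\<close>, hence is left alone by the retraction.
\<close>

theorem prob_simplex_fixpoint:
  fixes F :: "('a \<Rightarrow> real) \<Rightarrow> 'a \<Rightarrow> real"
  assumes fin: "finite I" and ne: "I \<noteq> {}"
    and cont: "continuous_on (prob_simplex I) F"
    and maps: "F ` prob_simplex I \<subseteq> prob_simplex I"
  obtains p where "p \<in> prob_simplex I" "F p = p"
proof -
  define n where "n = card I"
  have n: "n \<noteq> 0" using fin ne by (simp add: n_def card_gt_0_iff)
  obtain e where e: "bij_betw e {..<n} I"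
    using bij_betw_from_nat_into_finite[OF fin] by (auto simp: n_def)
  define e' where "e' = inv_into {..<n} e"
  have e': "e' a < n" "e (e' a) = a" if "a \<in> I" for a
    using that e bij_betw_inv_into_right[OF e that] bij_betwE[OF bij_betw_inv_into[OF e]]
    by (auto simp: e'_def)
  have e'e: "e' (e i) = i" "e i \<in> I" if "i < n" for i
    using that e bij_betw_inv_into_left[OF e] bij_betwE[OF e] by (auto simp: e'_def)
  define norml where "norml x = (\<lambda>a. if a \<in> I then
      x (e' a) / max 1 (\<Sum>i<n. x i) + max 0 (1 - (\<Sum>i<n. x i)) / real n else 0)"
    for x :: "nat \<Rightarrow> real"
  have sum_e: "(\<Sum>a\<in>I. h (e' a)) = (\<Sum>i<n. h i)" for h :: "nat \<Rightarrow> real"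
    using sum.reindex_bij_betw[OF e, of "\<lambda>a. h (e' a)"] e'e by simp
  have norml: "norml x \<in> prob_simplex I" if "x \<in> unit_cube n" for x
  proof -
    have x: "0 \<le> x i" for i using that by (cases "i < n") (auto simp: mem_unit_cube_iff)
    have "(\<Sum>a\<in>I. norml x a) =
        (\<Sum>i<n. x i / max 1 (\<Sum>i<n. x i) + max 0 (1 - (\<Sum>i<n. x i)) / real n)"
      by (simp add: norml_def flip: sum_e)
    also have "\<dots> = (\<Sum>i<n. x i) / max 1 (\<Sum>i<n. x i) + max 0 (1 - (\<Sum>i<n. x i))"
      using n by (simp add: sum.distrib sum_divide_distrib)
    also have "\<dots> = 1" by (simp add: max_def)
    finally show ?thesis
      using x by (auto simp: prob_simplex_def norml_def)
  qed
  define g where "g x = (\<lambda>i. if i < n then F (norml x) (e i) else 0)" for x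
  have "continuous_on (unit_cube n) (\<lambda>x. norml x a)" for a
  proof (cases "a \<in> I")
    case True
    then show ?thesis
      by (auto simp: norml_def intro!: continuous_on_coordinate continuous_on_max
            continuous_on_divide continuous_on_add continuous_on_diff continuous_on_sum
            continuous_on_const simp: n)
  qed (simp add: norml_def)
  then have "continuous_on (unit_cube n) norml"
    by (rule continuous_on_coordinatewise_then_product)
  then have "continuous_on (unit_cube n) (\<lambda>x. F (norml x))"
    by (rule continuous_on_compose2[OF cont]) (use norml in auto)
  then have "continuous_on (unit_cube n) (\<lambda>x. F (norml x) a)" for a
    by (rule continuous_on_product_then_coordinatewise)
  then have "continuous_on (unit_cube n) (\<lambda>x. if i < n then F (norml x) (e i) else 0)" for i
    by (cases "i < n") simp_all
  then have "continuous_on (unit_cube n) g"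
    unfolding g_def by (rule continuous_on_coordinatewise_then_product)
  moreover have Fn: "F (norml x) \<in> prob_simplex I" if "x \<in> unit_cube n" for x
    using maps norml[OF that] by blast
  have "p a \<le> 1" if "p \<in> prob_simplex I" for p a
    using that member_le_sum[of a I p] fin by (cases "a \<in> I") (auto simp: prob_simplex_def)
  then have "g ` unit_cube n \<subseteq> unit_cube n"
    using Fn by (fastforce simp: mem_unit_cube_iff g_def prob_simplex_def)
  ultimately obtain x where x: "x \<in> unit_cube n" "g x = x"
    by (rule unit_cube_fixpoint)
  have xe: "x (e' a) = F (norml x) a" if "a \<in> I" for a
    using x(2) e'[OF that] by (metis g_def)
  have "(\<Sum>i<n. x i) = (\<Sum>a\<in>I. F (norml x) a)"
    using xe by (simp flip: sum_e)
  also have "\<dots> = 1" using Fn[OF x(1)] by (simp add: prob_simplex_def)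
  finally have "norml x a = F (norml x) a" for a
    using xe Fn[OF x(1)] by (auto simp: norml_def prob_simplex_def)
  then show thesis
    using that norml[OF x(1)] by (metis ext)
qed

section \<open>Self-reproducing laws\<close>

lemma sum_prod_tuples:
  fixes p :: "'a \<Rightarrow> real"
  assumes "finite A"
  shows "(\<Sum>X\<in>{..<k::nat} \<rightarrow>\<^sub>E A. \<Prod>j<k. p (X j)) = sum p A ^ k"
  using prod_sum_PiE[of "{..<k}" "\<lambda>_. A" "\<lambda>_. p"] assms by simp

lemma self_reproducing_law:
  fixes w :: "(nat \<Rightarrow> 'a) \<Rightarrow> 'a"
  assumes fin: "finite V" and ne: "V \<noteq> {}"
    and w: "\<And>X. X \<in> {..<k} \<rightarrow>\<^sub>E V \<Longrightarrow> w X \<in> V"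
  obtains p where "p \<in> prob_simplex V"
    "\<And>a. p a = (\<Sum>X | X \<in> ({..<k} \<rightarrow>\<^sub>E V) \<and> w X = a. \<Prod>j<k. p (X j))"
proof -
  let ?P = "{..<k} \<rightarrow>\<^sub>E V"
  define F where "F p = (\<lambda>a. \<Sum>X | X \<in> ?P \<and> w X = a. \<Prod>j<k. p (X j))" for p :: "'a \<Rightarrow> real"
  have finP: "finite ?P" using fin by (intro finite_PiE) auto
  have "continuous_on (prob_simplex V) F"
    unfolding F_def
    by (intro continuous_on_coordinatewise_then_product)
       (intro continuous_on_sum continuous_on_prod continuous_on_coordinate)
  moreover have "F p \<in> prob_simplex V" if p: "p \<in> prob_simplex V" for p
  proof -
    have "sum (F p) V = (\<Sum>X\<in>?P. \<Prod>j<k. p (X j))"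
      unfolding F_def using sum.group[OF finP fin, of w "\<lambda>X. \<Prod>j<k. p (X j)"] w by blast
    also have "\<dots> = 1" using p by (simp add: sum_prod_tuples[OF fin] prob_simplex_def)
    moreover have "F p a = 0" if "a \<notin> V" for a
    proof -
      have "{X \<in> ?P. w X = a} = {}" using w that by blast
      then show ?thesis unfolding F_def by (simp only: sum.empty)
    qed
    moreover have "0 \<le> F p a" for a
      using p by (auto simp: F_def prob_simplex_def intro!: sum_nonneg prod_nonneg)
    ultimately show ?thesis by (simp add: prob_simplex_def)
  qed
  ultimately obtain p where p: "p \<in> prob_simplex V" "F p = p"
    using prob_simplex_fixpoint[OF fin ne] by blast
  have "p a = (\<Sum>X | X \<in> ?P \<and> w X = a. \<Prod>j<k. p (X j))" for a
    using fun_cong[OF p(2), of a] unfolding F_def by (rule sym)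
  with p(1) show thesis by (rule that)
qed

text \<open>
  The left-hand side is the probability that \<open>w X \<in> B\<close>, the right-hand side the probability
  that the \<open>k\<close> independent entries of \<open>X\<close> all avoid \<open>A\<close>.
\<close>

lemma self_reproducing_law_avoid:
  assumes fin: "finite V" and p: "p \<in> prob_simplex V"
    and law: "\<And>a. p a = (\<Sum>X | X \<in> ({..<k} \<rightarrow>\<^sub>E V) \<and> w X = a. \<Prod>j<k. p (X j))"
    and sub: "A \<subseteq> V" "B \<subseteq> V"
    and avoid: "\<And>X j. X \<in> {..<k} \<rightarrow>\<^sub>E V \<Longrightarrow> w X \<in> B \<Longrightarrow> j < k \<Longrightarrow> X j \<notin> A"
  shows "sum p B \<le> (1 - sum p A) ^ k"
proof -
  let ?P = "{..<k} \<rightarrow>\<^sub>E V"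
  have finP: "finite ?P" using fin by (intro finite_PiE) auto
  have p0: "0 \<le> p a" for a using p by (simp add: prob_simplex_def)
  have "sum p B = (\<Sum>b\<in>B. \<Sum>X | X \<in> {X \<in> ?P. w X \<in> B} \<and> w X = b. \<Prod>j<k. p (X j))"
  proof (rule sum.cong)
    fix b assume "b \<in> B"
    then have eq: "{X \<in> ?P. w X = b} = {X \<in> {X \<in> ?P. w X \<in> B}. w X = b}" by auto
    show "p b = (\<Sum>X | X \<in> {X \<in> ?P. w X \<in> B} \<and> w X = b. \<Prod>j<k. p (X j))"
      using law[of b] unfolding eq .
  qed simp
  also have "\<dots> = (\<Sum>X | X \<in> ?P \<and> w X \<in> B. \<Prod>j<k. p (X j))"
    using finP finite_subset[OF sub(2) fin] by (intro sum.group) auto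
  also have "\<dots> \<le> (\<Sum>X \<in> {..<k} \<rightarrow>\<^sub>E (V - A). \<Prod>j<k. p (X j))"
  proof (rule sum_mono2)
    show "finite ({..<k} \<rightarrow>\<^sub>E (V - A))" using fin by (intro finite_PiE) auto
    show "{X \<in> ?P. w X \<in> B} \<subseteq> {..<k} \<rightarrow>\<^sub>E (V - A)"
    proof
      fix X assume "X \<in> {X \<in> ?P. w X \<in> B}"
      then show "X \<in> {..<k} \<rightarrow>\<^sub>E (V - A)" using avoid[of X] by (auto simp: PiE_iff)
    qed
    show "0 \<le> (\<Prod>j<k. p (X j))" for X using p0 by (intro prod_nonneg) simp
  qed
  also have "\<dots> = (1 - sum p A) ^ k"
    using fin sub p by (simp add: sum_prod_tuples sum_diff prob_simplex_def finite_subset)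
  finally show ?thesis .
qed

section \<open>Medians of linear orders\<close>

lemma finite_least:
  assumes "finite S" "S \<noteq> {}"
    and "\<And>x y. x \<in> S \<Longrightarrow> y \<in> S \<Longrightarrow> x \<noteq> y \<Longrightarrow> R x y \<or> R y x"
    and "\<And>x y z. x \<in> S \<Longrightarrow> y \<in> S \<Longrightarrow> z \<in> S \<Longrightarrow> R x y \<Longrightarrow> R y z \<Longrightarrow> R x z"
  shows "\<exists>t\<in>S. \<forall>x\<in>S. x = t \<or> R t x"
  using assms
proof (induction S rule: finite_ne_induct)
  case (singleton a)
  show ?case by simp
next
  case (insert a S)
  have "\<exists>t\<in>S. \<forall>x\<in>S. x = t \<or> R t x"
  proof (rule insert.IH)
    show "R x y \<or> R y x" if "x \<in> S" "y \<in> S" "x \<noteq> y" for x y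
      by (rule insert.prems(1)) (use that in simp_all)
    show "R x z" if "x \<in> S" "y \<in> S" "z \<in> S" "R x y" "R y z" for x y z
      by (rule insert.prems(2)[of x y z]) (use that in simp_all)
  qed
  then obtain t where t: "t \<in> S" and least: "\<And>x. x \<in> S \<Longrightarrow> x = t \<or> R t x"
    by blast
  show ?case
  proof (cases "R a t")
    case True
    have "x = a \<or> R a x" if "x \<in> insert a S" for x
    proof (cases "x = a \<or> x = t")
      case False
      then have "R t x" "x \<in> S" using that least by auto
      then show ?thesis using insert.prems(2)[of a t x] True t by simp
    qed (use True in auto)
    then show ?thesis by blast
  next
    case False
    have "a = t \<or> R t a" using insert.prems(1)[of a t] t False by auto
    then have "x = t \<or> R t x" if "x \<in> insert a S" for x
      using that least by auto
    then show ?thesis using t by blast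
  qed
qed

text \<open>
  Atoms prevent an exact halving, but \<open>t\<close> may be counted on both sides. It is the first element
  whose initial segment reaches mass \<open>\<theta>\<close>; the elements before it form an initial segment of
  mass less than \<open>\<theta>\<close>, so more than half of \<open>2 * \<theta>\<close> remains from \<open>t\<close> on.
\<close>

lemma weighted_median:
  fixes p :: "'a \<Rightarrow> real"
  assumes fin: "finite S"
    and total: "\<And>x y. x \<in> S \<Longrightarrow> y \<in> S \<Longrightarrow> x \<noteq> y \<Longrightarrow> R x y \<or> R y x"
    and trans: "\<And>x y z. x \<in> S \<Longrightarrow> y \<in> S \<Longrightarrow> z \<in> S \<Longrightarrow> R x y \<Longrightarrow> R y z \<Longrightarrow> R x z"
    and p0: "\<And>x. 0 \<le> p x" and \<theta>: "0 < \<theta>" "2 * \<theta> \<le> sum p S"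
  obtains t where "t \<in> S" "\<theta> \<le> sum p {x \<in> S. x = t \<or> R x t}"
    "\<theta> < sum p {x \<in> S. x = t \<or> R t x}"
proof -
  define A where "A = {y \<in> S. sum p {x \<in> S. x = y \<or> R x y} < \<theta>}"
  have A: "A \<subseteq> S" "finite A" using fin by (auto simp: A_def)
  have "sum p A < \<theta>"
  proof (cases "A = {}")
    case False
    have "\<exists>m\<in>A. \<forall>x\<in>A. x = m \<or> R x m"
    proof (rule finite_least[OF A(2) False])
      show "R y x \<or> R x y" if "x \<in> A" "y \<in> A" "x \<noteq> y" for x y
        using that A(1) total by blast
      show "R z x" if "x \<in> A" "y \<in> A" "z \<in> A" "R y x" "R z y" for x y z
        using that A(1) trans[of z y x] by blast
    qed
    then obtain m where m: "m \<in> A" "\<forall>x\<in>A. x = m \<or> R x m" by blast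
    have "sum p A \<le> sum p {x \<in> S. x = m \<or> R x m}"
      using m A fin p0 by (intro sum_mono2) auto
    also have "\<dots> < \<theta>" using m by (simp add: A_def)
    finally show ?thesis .
  qed (use \<theta> in simp)
  then have gt: "\<theta> < sum p (S - A)"
    using \<theta> A fin by (simp add: sum_diff)
  then have ne: "S - A \<noteq> {}" using \<theta>(1) by (metis less_asym sum.empty)
  have "\<exists>t\<in>S - A. \<forall>x\<in>S - A. x = t \<or> R t x"
  proof (rule finite_least[OF _ ne])
    show "R x y \<or> R y x" if "x \<in> S - A" "y \<in> S - A" "x \<noteq> y" for x y
      using that total by blast
    show "R x z" if "x \<in> S - A" "y \<in> S - A" "z \<in> S - A" "R x y" "R y z" for x y z
      using that trans[of x y z] by blast
  qed (use fin in simp)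
  then obtain t where t: "t \<in> S - A" "\<forall>x\<in>S - A. x = t \<or> R t x" by blast
  have "sum p (S - A) \<le> sum p {x \<in> S. x = t \<or> R t x}"
    using t fin p0 by (intro sum_mono2) auto
  with gt have late: "\<theta> < sum p {x \<in> S. x = t \<or> R t x}" by simp
  have early: "\<theta> \<le> sum p {x \<in> S. x = t \<or> R x t}"
    using t(1) unfolding A_def by (simp add: not_less)
  show thesis by (rule that[OF _ early late]) (use t(1) in simp)
qed

section \<open>Transitive sets and domination\<close>

context digraph
begin

lemma transitive_sets_no_triangle:
  assumes S: "S \<in> transitive_sets G" and xyz: "x \<in> S" "y \<in> S" "z \<in> S"
    and arcs: "x \<rightarrow> y" "y \<rightarrow> z" "z \<rightarrow> x"
  shows False
proof -
  obtain a b c where abc: "a \<in> arcs G" "tail G a = x" "head G a = y"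
    "b \<in> arcs G" "tail G b = y" "head G b = z" "c \<in> arcs G" "tail G c = z" "head G c = x"
    using arcs unfolding arcs_ends_def arc_to_ends_def image_iff by (metis prod.inject)
  have ne: "x \<noteq> y" "y \<noteq> z" "z \<noteq> x" using arcs adj_not_same by blast+
  have "pre_digraph.awalk (G \<restriction> S) x [a, b, c] x"
    using abc xyz by (simp add: pre_digraph.awalk_def pre_digraph.cas.simps)
  moreover have "distinct (tl (pre_digraph.awalk_verts (G \<restriction> S) x [a, b, c]))"
    using abc ne by (simp add: pre_digraph.awalk_verts.simps)
  ultimately have "pre_digraph.cycle (G \<restriction> S) [a, b, c]"
    unfolding pre_digraph.cycle_def by blast
  then show False using S by (auto simp: transitive_sets_def)
qed

text \<open>
  Averaging the covering constraints of a fractional dicolouring \<open>z\<close> over \<open>p\<close> gives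
  \<open>1 \<le> (\<Sum>S. z S * p S)\<close>, at most the objective value of \<open>z\<close> times the largest mass of a
  transitive set. That mass is at most \<open>1\<close>, which also bounds \<open>c\<close> from below.
\<close>

lemma heavy_transitive_set:
  assumes p: "p \<in> prob_simplex (verts G)" and ne: "verts G \<noteq> {}"
    and c: "fractional_dichromatic_number G \<le> c"
  shows "1 \<le> c" and "\<exists>S \<in> transitive_sets G. 1 / c \<le> sum p S"
proof -
  let ?TS = "transitive_sets G"
  have p0: "\<And>v. 0 \<le> p v" and p1: "sum p (verts G) = 1"
    using p by (auto simp: prob_simplex_def)
  have sub: "S \<subseteq> verts G" if "S \<in> ?TS" for S using that by (simp add: transitive_sets_def)
  define M where "M = Max (sum p ` ?TS)"
  have "?TS \<noteq> {}" using ne singleton_in_transitive_sets by blast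
  then have "M \<in> sum p ` ?TS"
    unfolding M_def by (intro Max_in finite_imageI finite_transitive_sets) simp
  then obtain S where S: "S \<in> ?TS" "sum p S = M" by blast
  have M_ge: "sum p S \<le> M" if "S \<in> ?TS" for S
    using that finite_transitive_sets by (auto simp: M_def)
  have "sum p S \<le> sum p (verts G)" using sub[OF S(1)] p0 by (intro sum_mono2) auto
  then have "M \<le> 1" using S p1 by simp
  have obj: "1 \<le> M * (\<Sum>S\<in>?TS. z S)" if z: "fractional_dicolouring G z" for z
  proof -
    have "1 = (\<Sum>v\<in>verts G. p v * 1)" using p1 by simp
    also have "\<dots> \<le> (\<Sum>v\<in>verts G. p v * (\<Sum>S | S \<in> ?TS \<and> v \<in> S. z S))"
      using z p0 by (intro sum_mono mult_left_mono) (auto simp: fractional_dicolouring_def)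
    also have "\<dots> = (\<Sum>v\<in>verts G. \<Sum>S | S \<in> ?TS \<and> v \<in> S. p v * z S)"
      by (simp add: sum_distrib_left)
    also have "\<dots> = (\<Sum>S\<in>?TS. \<Sum>v | v \<in> verts G \<and> v \<in> S. p v * z S)"
      by (rule sum.swap_restrict) (use finite_transitive_sets in auto)
    also have "\<dots> = (\<Sum>S\<in>?TS. sum p S * z S)"
      using sub by (intro sum.cong refl) (auto simp: sum_distrib_right intro!: sum.cong)
    also have "\<dots> \<le> (\<Sum>S\<in>?TS. M * z S)"
      using z M_ge by (intro sum_mono mult_right_mono) (auto simp: fractional_dicolouring_def)
    finally show ?thesis by (simp add: sum_distrib_left)
  qed
  have M_pos: "0 < M"
  proof (rule ccontr)
    assume "\<not> 0 < M"
    then have "M * (\<Sum>S\<in>?TS. 1) \<le> 0" by (intro mult_nonpos_nonneg) auto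
    with obj[OF fractional_dicolouring_exists] show False by simp
  qed
  have "1 / M \<le> fractional_dichromatic_number G"
    unfolding fractional_dichromatic_number_def
  proof (rule cInf_greatest)
    show "{\<Sum>S\<in>?TS. z S |z. fractional_dicolouring G z} \<noteq> {}"
      using fractional_dicolouring_exists by blast
  qed (use obj M_pos in \<open>auto simp: field_simps\<close>)
  with c have Mc: "1 / M \<le> c" by simp
  moreover have "1 \<le> 1 / M" using M_pos \<open>M \<le> 1\<close> by simp
  ultimately show "1 \<le> c" by simp
  with Mc M_pos have "1 / c \<le> M" by (simp add: field_simps)
  with S show "\<exists>S \<in> ?TS. 1 / c \<le> sum p S" by blast
qed

lemma fractional_dichromatic_number_nonneg: "0 \<le> fractional_dichromatic_number G"
  unfolding fractional_dichromatic_number_def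
proof (rule cInf_greatest)
  show "{\<Sum>S\<in>transitive_sets G. z S |z. fractional_dicolouring G z} \<noteq> {}"
    using fractional_dicolouring_exists by blast
qed (auto simp: fractional_dicolouring_def intro!: sum_nonneg)

lemma domination_number_le:
  "dominating_set G X \<Longrightarrow> domination_number G \<le> card X"
  unfolding domination_number_def
  by (rule Min_le[OF finite_card_dominating_sets]) blast

lemma beating_vertex:
  assumes k: "k < domination_number G" and X: "X \<in> {..<k} \<rightarrow>\<^sub>E verts G"
  shows "\<exists>u. u \<in> verts G \<and> (\<forall>j<k. X j \<noteq> u \<and> \<not> X j \<rightarrow> u)"
proof -
  have "card (X ` {..<k}) < domination_number G"
    using card_image_le[of "{..<k}" X] k by simp
  then have "\<not> dominating_set G (X ` {..<k})"
    using domination_number_le leD by blast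
  then show ?thesis
    using X by (auto simp: dominating_set_def PiE_iff)
qed

end

lemma (in tournament) transitive_sets_trans:
  assumes S: "S \<in> transitive_sets G" and xyz: "x \<in> S" "y \<in> S" "z \<in> S"
    and arcs: "x \<rightarrow> y" "y \<rightarrow> z"
  shows "x \<rightarrow> z"
proof (rule ccontr)
  assume no: "\<not> x \<rightarrow> z"
  have V: "x \<in> verts G" "z \<in> verts G" "y \<in> verts G"
    using S xyz by (auto simp: transitive_sets_def)
  have "x \<noteq> y" using arcs(1) adj_not_same by blast
  then have "x \<noteq> z" using arcs V exactly_one_arc[of x y] by blast
  then have "z \<rightarrow> x" using no V exactly_one_arc by blast
  then show False using transitive_sets_no_triangle[OF S xyz arcs] by blast
qed

section \<open>The domination bound\<close>

lemma power_one_minus_inverse_le: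
  fixes y :: real
  assumes y: "1 \<le> y" and k: "y * ln y \<le> real k"
  shows "(1 - 1 / y) ^ k \<le> 1 / y"
proof -
  have "(1 - 1 / y) ^ k \<le> exp (- (1 / y)) ^ k"
    using y exp_ge_add_one_self[of "- (1 / y)"] by (intro power_mono) auto
  also have "\<dots> = exp (- (real k / y))"
    by (simp add: exp_of_nat_mult[symmetric])
  also have "\<dots> \<le> exp (- ln y)"
    using y k by (simp add: field_simps)
  also have "\<dots> = 1 / y"
    using y by (simp add: exp_minus inverse_eq_divide)
  finally show ?thesis .
qed

theorem theorem5:
  fixes T :: "('a, 'b) pre_digraph" and c :: real
  assumes "tournament T"
    and "fractional_dichromatic_number T \<le> c"
  shows "int (domination_number T) \<le> \<lceil>2 * c * ln (2 * c)\<rceil>"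
proof -
  interpret tournament T by fact
  show ?thesis
  proof (cases "verts T = {}")
    case True
    then have "domination_number T \<le> 0"
      using domination_number_le[OF dominating_set_verts] by simp
    (* Here c may be less than 1 / 2 and the logarithm negative; the bound must still round
       up to at least 0. *)
    moreover have "- 1 < 2 * c * ln (2 * c)"
    proof (cases "c = 0")
      case False
      then have c: "0 < c"
        using assms(2) fractional_dichromatic_number_nonneg by linarith
      then have "- ln (2 * c) \<le> 1 / (2 * c) - 1"
        using ln_le_minus_one[of "1 / (2 * c)"] by (simp add: ln_div)
      then have "2 * c * (- ln (2 * c)) \<le> 2 * c * (1 / (2 * c) - 1)"
        using c by (intro mult_left_mono) auto
      then show ?thesis using c by (simp add: algebra_simps)
    qed simp
    ultimately show ?thesis by linarith
  next
    case False
    show ?thesis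
    proof (rule ccontr)
      assume neg: "\<not> ?thesis"
      define k where "k = nat \<lceil>2 * c * ln (2 * c)\<rceil>"
      define w where "w X = (SOME u. u \<in> verts T \<and> (\<forall>j<k. X j \<noteq> u \<and> \<not> X j \<rightarrow>\<^bsub>T\<^esub> u))" for X
      have c: "1 \<le> c"
      proof -
        obtain v where v: "v \<in> verts T" using False by blast
        then have "(\<lambda>u. if u = v then 1 else 0) \<in> prob_simplex (verts T)"
          by (auto simp: prob_simplex_def)
        then show ?thesis using heavy_transitive_set(1)[OF _ False assms(2)] by blast
      qed
      have k: "2 * c * ln (2 * c) \<le> real k"
        unfolding k_def by linarith
      have "0 \<le> 2 * c * ln (2 * c)" using c by simp
      then have "k < domination_number T"
        using neg unfolding k_def by linarith
      then have w: "w X \<in> verts T \<and> (\<forall>j<k. X j \<noteq> w X \<and> \<not> X j \<rightarrow>\<^bsub>T\<^esub> w X)"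
        if "X \<in> {..<k} \<rightarrow>\<^sub>E verts T" for X
        unfolding w_def by (rule someI_ex[OF beating_vertex[OF _ that]])
      obtain p where p: "p \<in> prob_simplex (verts T)"
        and law: "\<And>a. p a = (\<Sum>X | X \<in> ({..<k} \<rightarrow>\<^sub>E verts T) \<and> w X = a. \<Prod>j<k. p (X j))"
        by (rule self_reproducing_law[OF finite_verts False, of k w]) (use w in blast)+
      obtain S where S: "S \<in> transitive_sets T" and heavy: "1 / c \<le> sum p S"
        using heavy_transitive_set(2)[OF p False assms(2)] by blast
      have SV: "S \<subseteq> verts T" using S by (simp add: transitive_sets_def)
      then have finS: "finite S" by (rule finite_subset) simp
      obtain t where t: "t \<in> S"
        and early: "1 / (2 * c) \<le> sum p {x \<in> S. x = t \<or> x \<rightarrow>\<^bsub>T\<^esub> t}"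
        and late: "1 / (2 * c) < sum p {x \<in> S. x = t \<or> t \<rightarrow>\<^bsub>T\<^esub> x}"
      proof (rule weighted_median[of S "\<lambda>x y. x \<rightarrow>\<^bsub>T\<^esub> y" p "1 / (2 * c)"])
        show "x \<rightarrow>\<^bsub>T\<^esub> y \<or> y \<rightarrow>\<^bsub>T\<^esub> x" if "x \<in> S" "y \<in> S" "x \<noteq> y" for x y
          using that SV exactly_one_arc by blast
        show "x \<rightarrow>\<^bsub>T\<^esub> z" if "x \<in> S" "y \<in> S" "z \<in> S" "x \<rightarrow>\<^bsub>T\<^esub> y" "y \<rightarrow>\<^bsub>T\<^esub> z" for x y z
          using transitive_sets_trans[OF S] that by blast
      qed (use finS p c heavy in \<open>auto simp: prob_simplex_def\<close>)
      let ?A = "{x \<in> S. x = t \<or> x \<rightarrow>\<^bsub>T\<^esub> t}" and ?B = "{x \<in> S. x = t \<or> t \<rightarrow>\<^bsub>T\<^esub> x}"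
      have AB: "x = u \<or> x \<rightarrow>\<^bsub>T\<^esub> u" if "x \<in> ?A" "u \<in> ?B" for x u
        using that t transitive_sets_trans[OF S, of x t u] by blast
      have "sum p ?B \<le> (1 - sum p ?A) ^ k"
      proof (rule self_reproducing_law_avoid[OF finite_verts p law])
        show "X j \<notin> ?A" if "X \<in> {..<k} \<rightarrow>\<^sub>E verts T" "w X \<in> ?B" "j < k" for X j
          using AB[OF _ that(2)] w[OF that(1)] that(3) by blast
      qed (use SV in auto)
      also have "\<dots> \<le> (1 - 1 / (2 * c)) ^ k"
      proof (rule power_mono)
        have "sum p ?A \<le> sum p (verts T)"
          using SV p by (intro sum_mono2) (auto simp: prob_simplex_def)
        then show "0 \<le> 1 - sum p ?A" using p by (simp add: prob_simplex_def)
      qed (use early in simp)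
      also have "\<dots> \<le> 1 / (2 * c)"
        using c k by (intro power_one_minus_inverse_le) auto
      finally show False using late by simp
    qed
  qed
qed

end
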